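(* For $n=8$ teams there exists a feasible, single-break, ranking-fair schedule whose D-sequence is a cyclic rotation, or the reversal of a cyclic rotation, of $(2,2,2,1)$; i.e., the canonical pattern set allows a ranking-fair schedule for $n=8$.
   Context: Teams are $T=\{1,\dots,n\}$ ($n$ even), ranked by strength: team $i$ is stronger than team $j$ iff $i<j$. Rounds are $R=\{1,\dots,n-1\}$. A schedule assigns to each unordered pair of distinct teams a round in $R$ and designates which of the two plays at home (the other away). It is feasible if every team plays exactly one game in every round. The ranking HAP of team $i$ is the vector $(p_1,\dots,p_{n-1})$, $p_m\in\{H,A\}$ indicating whether team $i$ plays home or away against its $m$-th strongest opponent (opponents in increasing order of index). A schedule is ranking-fair if every team's ranking HAP alternates between $H$ and $A$. The HAP of a team is $(h_1,\dots,h_{n-1})$ with $h_r$ its venue in round $r$, read cyclically ($h_0:=h_{n-1}$); a team has a break in round $r$ if $h_{r-1}=h_r$. A schedule is single-break if every team has exactly one break. In a feasible single-break schedule the breaks occur in exactly $n/2$ distinct rounds $r_1<\dots<r_{n/2}$; the D-sequence is $(d_1,\dots,d_{n/2})$ with $d_i=r_{i+1}-r_i$ and $r_{n/2+1}:=r_1+n-1$. The canonical pattern set is the HAP set of a single-break schedule with D-sequence $(2,\dots,2,1)$ up to cyclic rotation and reversal. *)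

theory Defs
  imports Main
begin

(* Teams are ranked by strength: i is stronger than j iff i < j. *)
definition teams :: "nat \<Rightarrow> nat set" where
  "teams n = {1..n}"

definition rounds :: "nat \<Rightarrow> nat set" where
  "rounds n = {1..n - 1}"

datatype venue = H | A

(* Both fields are indexed by the unordered pair {i, j}; their values on sets that are
   not pairs of distinct teams are irrelevant. *)
record schedule =
  game_round :: "nat set \<Rightarrow> nat"
  home_team :: "nat set \<Rightarrow> nat"

definition is_schedule :: "nat \<Rightarrow> schedule \<Rightarrow> bool" where
  "is_schedule n S \<longleftrightarrow>
     (\<forall>i\<in>teams n. \<forall>j\<in>teams n. i \<noteq> j \<longrightarrow>
        game_round S {i, j} \<in> rounds n \<and> home_team S {i, j} \<in> {i, j})"

definition feasible :: "nat \<Rightarrow> schedule \<Rightarrow> bool" where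
  "feasible n S \<longleftrightarrow>
     (\<forall>i\<in>teams n. \<forall>r\<in>rounds n. \<exists>!j. j \<in> teams n - {i} \<and> game_round S {i, j} = r)"

definition venue_against :: "schedule \<Rightarrow> nat \<Rightarrow> nat \<Rightarrow> venue" where
  "venue_against S i j = (if home_team S {i, j} = i then H else A)"

definition ranking_HAP :: "nat \<Rightarrow> schedule \<Rightarrow> nat \<Rightarrow> venue list" where
  "ranking_HAP n S i = map (venue_against S i) (sorted_list_of_set (teams n - {i}))"

(* distinct_adj: no two consecutive entries are equal, i.e. H and A alternate. *)
definition ranking_fair :: "nat \<Rightarrow> schedule \<Rightarrow> bool" where
  "ranking_fair n S \<longleftrightarrow> (\<forall>i\<in>teams n. distinct_adj (ranking_HAP n S i))"

(* Well defined for feasible schedules. *)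
definition opponent :: "nat \<Rightarrow> schedule \<Rightarrow> nat \<Rightarrow> nat \<Rightarrow> nat" where
  "opponent n S i r = (THE j. j \<in> teams n - {i} \<and> game_round S {i, j} = r)"

(* Read cyclically: index 0 denotes round n - 1. *)
definition HAP :: "nat \<Rightarrow> schedule \<Rightarrow> nat \<Rightarrow> nat \<Rightarrow> venue" where
  "HAP n S i r = venue_against S i (opponent n S i (if r = 0 then n - 1 else r))"

definition has_break :: "nat \<Rightarrow> schedule \<Rightarrow> nat \<Rightarrow> nat \<Rightarrow> bool" where
  "has_break n S i r \<longleftrightarrow> HAP n S i (r - 1) = HAP n S i r"

definition single_break :: "nat \<Rightarrow> schedule \<Rightarrow> bool" where
  "single_break n S \<longleftrightarrow> (\<forall>i\<in>teams n. \<exists>!r. r \<in> rounds n \<and> has_break n S i r)"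

definition break_rounds :: "nat \<Rightarrow> schedule \<Rightarrow> nat set" where
  "break_rounds n S = {r \<in> rounds n. \<exists>i\<in>teams n. has_break n S i r}"

(* The gaps between consecutive break rounds r_1 < ... < r_k, where the successor of r_k
   is r_1 + n - 1; the subtraction on nat never truncates. *)
definition D_sequence :: "nat \<Rightarrow> schedule \<Rightarrow> nat list" where
  "D_sequence n S =
     (let rs = sorted_list_of_set (break_rounds n S)
      in map2 (-) (tl rs @ [hd rs + (n - 1)]) rs)"

end

theory Submission
  imports Defs
begin

text \<open>
  Alternation forces the venues up to a global swap: against teams \<open>j > i\<close> the venue of team
  \<open>i\<close> alternates with \<open>j\<close>, and symmetrically, so whether \<open>i\<close> hosts \<open>j\<close> depends only on the
  parity of \<open>i + j\<close>. We let the stronger team host exactly when this sum is even. Rotating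
  the rounds, one may take the breaks in rounds 1, 3, 5, 7. The rounds below were then found
  by a backtracking search over the assignments of the eight resulting HAPs to teams.
\<close>

text \<open>Entry \<open>j - 1\<close> of row \<open>i - 1\<close> is the round in which teams \<open>i\<close> and \<open>j\<close> meet;
  the diagonal is junk.\<close>

definition round_table :: "nat list list" where
  "round_table =
    [[0, 7, 1, 2, 6, 3, 4, 5],
     [7, 0, 6, 5, 1, 2, 3, 4],
     [1, 6, 0, 7, 4, 5, 2, 3],
     [2, 5, 7, 0, 3, 4, 1, 6],
     [6, 1, 4, 3, 0, 7, 5, 2],
     [3, 2, 5, 4, 7, 0, 6, 1],
     [4, 3, 2, 1, 5, 6, 0, 7],
     [5, 4, 3, 6, 2, 1, 7, 0]]"

definition meeting_round :: "nat \<Rightarrow> nat \<Rightarrow> nat" where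
  "meeting_round i j = round_table ! (i - 1) ! (j - 1)"

text \<open>\<open>Min\<close> and \<open>Max\<close> recover the stronger and the weaker team from
  an unordered pair, so the schedule reads only the upper triangle of the table.\<close>

definition canonical_schedule :: schedule where
  "canonical_schedule =
    \<lparr>game_round = (\<lambda>P. meeting_round (Min P) (Max P)),
     home_team = (\<lambda>P. if even (Min P + Max P) then Min P else Max P)\<rparr>"

definition venue_of :: "nat \<Rightarrow> nat \<Rightarrow> venue" where
  "venue_of i j = (if i < j \<longleftrightarrow> even (i + j) then H else A)"

text \<open>Computable counterpart of \<open>opponent\<close>: the head of a filtered list, unlike a
  definite description, can be evaluated by rewriting.\<close>

definition rival :: "nat \<Rightarrow> nat \<Rightarrow> nat" where
  "rival i r = hd (filter (\<lambda>j. j \<noteq> i \<and> meeting_round i j = r) [1..<9])"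

definition venue_in :: "nat \<Rightarrow> nat \<Rightarrow> venue" where
  "venue_in i r = venue_of i (rival i (if r = 0 then 7 else r))"

definition break_list :: "nat \<Rightarrow> nat list" where
  "break_list i = filter (\<lambda>r. venue_in i (r - 1) = venue_in i r) [1..<8]"

lemma teams_8: "teams 8 = set [1..<9]"
  by (auto simp: teams_def)

lemma rounds_8: "rounds 8 = set [1..<8]"
  by (auto simp: rounds_def)

lemma upt_1_9: "[1..<9] = [1, 2, 3, 4, 5, 6, 7, 8]"
  by (simp add: upt_rec)

lemma upt_1_8: "[1..<8] = [1, 2, 3, 4, 5, 6, 7]"
  by (simp add: upt_rec)

text \<open>Unfolding this single equation with \<open>list.inject\<close> yields all 64 entries as
  rewrite rules. Deleting \<open>One_nat_def\<close> keeps the literal 1, so that their left-hand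
  sides still match.\<close>

lemma meeting_round_table: "map (\<lambda>i. map (meeting_round i) [1..<9]) [1..<9] = round_table"
  by (simp add: upt_1_9 meeting_round_def round_table_def del: One_nat_def)

lemmas meeting_round_values =
  meeting_round_table [unfolded upt_1_9 round_table_def list.map list.inject simp_thms]

lemma rival_table: "map (\<lambda>i. map (rival i) [1..<8]) [1..<9] =
    [[3, 4, 6, 7, 8, 5, 2],
     [5, 6, 7, 8, 4, 3, 1],
     [1, 7, 8, 5, 6, 2, 4],
     [7, 1, 5, 6, 2, 8, 3],
     [2, 8, 4, 3, 7, 1, 6],
     [8, 2, 1, 4, 3, 7, 5],
     [4, 3, 2, 1, 5, 6, 8],
     [6, 5, 3, 2, 1, 4, 7]]"
  by (simp add: upt_1_9 upt_1_8 rival_def meeting_round_values del: One_nat_def)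

lemmas rival_values = rival_table [unfolded upt_1_9 upt_1_8 list.map list.inject simp_thms]

lemmas evaluation_simps = upt_1_9 upt_1_8 meeting_round_values rival_values venue_of_def
  venue_in_def break_list_def

lemma meeting_round_commute:
  assumes "i \<in> teams 8" "j \<in> teams 8"
  shows "meeting_round i j = meeting_round j i"
proof -
  have "\<forall>i\<in>set [1..<9]. \<forall>j\<in>set [1..<9]. meeting_round i j = meeting_round j i"
    by (simp add: evaluation_simps del: One_nat_def)
  with assms show ?thesis
    unfolding teams_8 by blast
qed

lemma meeting_round_in_rounds:
  assumes "i \<in> teams 8" "j \<in> teams 8" "i \<noteq> j"
  shows "meeting_round i j \<in> rounds 8"
proof -
  have "\<forall>i\<in>set [1..<9]. \<forall>j\<in>set [1..<9]. i \<noteq> j \<longrightarrow> meeting_round i j \<in> set [1..<8]"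
    by (simp add: evaluation_simps del: One_nat_def)
  with assms show ?thesis
    unfolding teams_8 rounds_8 by blast
qed

lemma meeting_round_eq_iff_rival:
  assumes "i \<in> teams 8" "r \<in> rounds 8"
  shows "j \<in> teams 8 - {i} \<and> meeting_round i j = r \<longleftrightarrow> j = rival i r"
proof -
  \<comment> \<open>That the filter leaves a one-element list gives existence and uniqueness of the
    opponent at once.\<close>
  have "\<forall>i\<in>set [1..<9]. \<forall>r\<in>set [1..<8].
      filter (\<lambda>j. j \<noteq> i \<and> meeting_round i j = r) [1..<9] = [rival i r]"
    by (simp add: evaluation_simps del: One_nat_def)
  then have "filter (\<lambda>j. j \<noteq> i \<and> meeting_round i j = r) [1..<9] = [rival i r]"
    using assms unfolding teams_8 rounds_8 by blast
  then have "j \<in> set (filter (\<lambda>j. j \<noteq> i \<and> meeting_round i j = r) [1..<9]) \<longleftrightarrow> j = rival i r"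
    by simp
  then show ?thesis
    unfolding teams_8 set_filter by blast
qed

lemma game_round_canonical:
  assumes "i \<in> teams 8" "j \<in> teams 8"
  shows "game_round canonical_schedule {i, j} = meeting_round i j"
  using meeting_round_commute[OF assms]
  by (simp add: canonical_schedule_def max_def min_def)

lemma venue_against_canonical:
  assumes "i \<noteq> j"
  shows "venue_against canonical_schedule i j = venue_of i j"
  using assms
  by (auto simp: venue_against_def canonical_schedule_def venue_of_def max_def min_def)

lemma is_schedule_canonical: "is_schedule 8 canonical_schedule"
  by (auto simp: is_schedule_def game_round_canonical meeting_round_in_rounds)
     (auto simp: canonical_schedule_def max_def min_def split: if_splits)

lemma game_round_eq_iff_rival:
  assumes "i \<in> teams 8" "r \<in> rounds 8"
  shows "j \<in> teams 8 - {i} \<and> game_round canonical_schedule {i, j} = r \<longleftrightarrow> j = rival i r"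
  using meeting_round_eq_iff_rival[OF assms, of j] game_round_canonical[OF assms(1), of j]
  by auto

lemma feasible_canonical: "feasible 8 canonical_schedule"
  unfolding feasible_def by (intro ballI, subst game_round_eq_iff_rival) auto

lemma opponent_canonical:
  assumes "i \<in> teams 8" "r \<in> rounds 8"
  shows "opponent 8 canonical_schedule i r = rival i r"
  unfolding opponent_def by (simp only: game_round_eq_iff_rival[OF assms] the_eq_trivial)

text \<open>The range includes index 0, which stands for round 7, because a break in round 1
  compares rounds 7 and 1.\<close>

lemma HAP_canonical:
  assumes "i \<in> teams 8" "r \<le> 7"
  shows "HAP 8 canonical_schedule i r = venue_in i r"
proof -
  define s where "s = (if r = 0 then 7 else r)"
  have s: "s \<in> rounds 8"
    using assms(2) by (auto simp: s_def rounds_def)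
  have "rival i s \<noteq> i"
    using meeting_round_eq_iff_rival[OF assms(1) s, of "rival i s"] by simp
  moreover have "(if r = 0 then 8 - 1 else r) = s"
    by (simp add: s_def)
  ultimately have "HAP 8 canonical_schedule i r = venue_of i (rival i s)"
    by (simp only: HAP_def opponent_canonical[OF assms(1) s] venue_against_canonical)
  then show ?thesis
    by (simp add: venue_in_def s_def)
qed

lemma has_break_canonical:
  assumes "i \<in> teams 8"
  shows "r \<in> rounds 8 \<and> has_break 8 canonical_schedule i r \<longleftrightarrow> r \<in> set (break_list i)"
  using assms by (auto simp: has_break_def HAP_canonical break_list_def rounds_def)

text \<open>Each break round is shared by two teams, here always \<open>i\<close> and
  \<open>9 - i\<close>.\<close>

lemma break_list_table: "map break_list [1..<9] = [[3], [5], [1], [7], [7], [1], [5], [3]]"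
  by (simp add: evaluation_simps flip: One_nat_def)

lemma single_break_canonical: "single_break 8 canonical_schedule"
proof -
  have "\<forall>i\<in>set [1..<9]. length (break_list i) = 1"
    using break_list_table by (simp add: upt_1_9 del: One_nat_def)
  then have "\<exists>!r. r \<in> set (break_list i)" if "i \<in> teams 8" for i
    using that unfolding teams_8 by (fastforce simp: length_Suc_conv)
  then show ?thesis
    by (simp add: single_break_def has_break_canonical)
qed

lemma break_rounds_canonical: "break_rounds 8 canonical_schedule = set [1, 3, 5, 7]"
proof -
  have "break_rounds 8 canonical_schedule = (\<Union>i\<in>teams 8. set (break_list i))"
    using has_break_canonical unfolding break_rounds_def by blast
  also have "\<dots> = set (concat (map break_list [1..<9]))"
    by (simp add: teams_8)
  also have "\<dots> = set [1, 3, 5, 7]"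
    unfolding break_list_table by auto
  finally show ?thesis .
qed

text \<open>The final 1 is the cyclic gap from round 7 back to round 1, namely (1 + 7) - 7.\<close>

lemma D_sequence_canonical: "D_sequence 8 canonical_schedule = [2, 2, 2, 1]"
proof -
  have "sorted_list_of_set (break_rounds 8 canonical_schedule) = [1, 3, 5, 7]"
    unfolding break_rounds_canonical by (subst sorted_list_of_set_sort_remdups) simp
  then show ?thesis
    by (simp add: D_sequence_def)
qed

lemma ranking_HAP_canonical:
  "ranking_HAP 8 canonical_schedule i = map (venue_of i) (filter (\<lambda>j. j \<noteq> i) [1..<9])"
proof -
  have "teams 8 - {i} = set (filter (\<lambda>j. j \<noteq> i) [1..<9])"
    by (auto simp: teams_def)
  then have "sorted_list_of_set (teams 8 - {i}) = filter (\<lambda>j. j \<noteq> i) [1..<9]"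
    by (simp only: sorted_list_of_set.idem_if_sorted_distinct sorted_wrt_filter
        distinct_filter distinct_upt sorted_upt)
  then show ?thesis
    unfolding ranking_HAP_def by (auto simp: venue_against_canonical)
qed

lemma ranking_fair_canonical: "ranking_fair 8 canonical_schedule"
proof -
  \<comment> \<open>Between neighbours \<open>j\<close> and \<open>j + 1\<close> on the same side of
    \<open>i\<close> the parity of the sum flips. From \<open>i - 1\<close> to \<open>i + 1\<close>
    the parity stays but the strength comparison flips. Either way the venue changes.\<close>
  have "\<forall>i\<in>set [1..<9]. distinct_adj (map (venue_of i) (filter (\<lambda>j. j \<noteq> i) [1..<9]))"
    by (simp add: evaluation_simps del: One_nat_def)
  then show ?thesis
    unfolding ranking_fair_def ranking_HAP_canonical teams_8 .
qed

theorem theorem2: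
  shows "\<exists>S :: schedule.
           is_schedule 8 S \<and> feasible 8 S \<and> single_break 8 S \<and> ranking_fair 8 S \<and>
           (\<exists>k. D_sequence 8 S = rotate k [2, 2, 2, 1] \<or>
                D_sequence 8 S = rev (rotate k [2, 2, 2, 1]))"
proof -
  have "D_sequence 8 canonical_schedule = rotate 0 [2, 2, 2, 1]"
    by (simp add: D_sequence_canonical)
  then show ?thesis
    using is_schedule_canonical feasible_canonical single_break_canonical ranking_fair_canonical
    by blast
qed

end
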